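(* Let $\bm{\mu}=(\mu_1,\dots,\mu_r)$ be probability measures on $\partial\mathbb{D}$ with Carathéodory functions $F_1,\dots,F_r$. Let $\bm{n}=(n_1,\dots,n_r)\in\mathbb{N}^r$ with all $n_j$ even, and put $\ell_j=n_j/2$, $|\bm{\ell}|=|\bm{n}|/2$, $L=\max_j\ell_j$. Consider the problem of finding Laurent polynomials $$\xi_{\bm{n},j}\in\operatorname{span}\{z^k\}_{k=-\ell_j}^{\ell_j-1}\ (j=1,\dots,r),\qquad \upsilon_{\bm{n}}\in\operatorname{span}\{z^k\}_{k=-L}^{L-1},\qquad(1)$$ that satisfy $$\sum_{j=1}^r\xi_{\bm{n},j}(z)F_j(z)+\upsilon_{\bm{n}}(z)=\mathcal{O}(z^{|\bm{\ell}|}),\quad z\to0,\qquad(2)$$ $$\sum_{j=1}^r\xi_{\bm{n},j}(z)F_j(z)+\upsilon_{\bm{n}}(z)=\mathcal{O}(z^{-|\bm{\ell}|}),\quad z\to\infty.\qquad(3)$$ If $\bm{\xi}_{\bm{n}}=(\xi_{\bm{n},1},\dots,\xi_{\bm{n},r})$ and $\upsilon_{\bm{n}}$ solve (1)–(3), then $\bm{\xi}_{\bm{n}}$ satisfies the orthogonality relations $$\sum_{j=1}^r\int\xi_{\bm{n},j}(w)w^{-k}\,d\mu_j(w)=0,\qquad k=-|\bm{\ell}|+1,\dots,|\bm{\ell}|-1,\qquad(4)$$ and $\upsilon_{\bm{n}}$ is given by $$\upsilon_{\bm{n}}(z)=\sum_{j=1}^r\int\frac{w+z}{w-z}\big(\xi_{\bm{n},j}(w)-\xi_{\bm{n},j}(z)\big)\,d\mu_j(w).\qquad(5)$$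 Conversely, any vector of Laurent polynomials $\bm{\xi}_{\bm{n}}=(\xi_{\bm{n},1},\dots,\xi_{\bm{n},r})$ with $\xi_{\bm{n},j}\in\operatorname{span}\{z^k\}_{k=-\ell_j}^{\ell_j-1}$ that satisfies (4) solves (2) and (3) together with the Laurent polynomial $\upsilon_{\bm{n}}$ given by (5).
   Context: $\mathbb{N}=\{0,1,2,\dots\}$; $\partial\mathbb{D}=\{z\in\mathbb{C}:|z|=1\}$; $|\bm{n}|=n_1+\dots+n_r$. The Carathéodory function of $\mu_j$ is $F_j(z)=\int_{\partial\mathbb{D}}\frac{w+z}{w-z}\,d\mu_j(w)$, $z\in\mathbb{C}\setminus\partial\mathbb{D}$. Spans are over $\mathbb{C}$; the span of an empty family (e.g. if $\ell_j=0$) is $\{0\}$. *)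

theory Defs
  imports "HOL-Complex_Analysis.Complex_Analysis" "HOL-Probability.Probability"
    "HOL-Library.Landau_Symbols"
begin

text \<open>The complex span of \<open>z\<^sup>k\<close>, \<open>a \<le> k \<le> b\<close>; it is \<open>{0}\<close> if \<open>b < a\<close>. The members are total
  functions, but only their values at \<open>z \<noteq> 0\<close> are meaningful.\<close>

definition laurent_span :: "int \<Rightarrow> int \<Rightarrow> (complex \<Rightarrow> complex) set" where
  "laurent_span a b = {f. \<exists>c :: int \<Rightarrow> complex. f = (\<lambda>z. \<Sum>k=a..b. c k * z powi k)}"

definition prob_measure_on_circle :: "complex measure \<Rightarrow> bool" where
  "prob_measure_on_circle M \<longleftrightarrow>
     prob_space M \<and> sets M = sets (restrict_space borel (sphere 0 1))"

text \<open>Meaningful for \<open>z\<close> off the unit circle.\<close>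

definition caratheodory :: "complex measure \<Rightarrow> complex \<Rightarrow> complex" where
  "caratheodory M z = (LINT w|M. (w + z) / (w - z))"

text \<open>For fixed \<open>z\<close>, the function \<open>w \<mapsto> (w + z) / (w - z) * (f w - f z)\<close> has a removable singularity
  at \<open>w = z\<close>, where it is extended continuously. This matters only if \<open>z\<close> lies on the unit circle:
  the measure may have an atom at \<open>z\<close>.\<close>

definition diff_kernel :: "(complex \<Rightarrow> complex) \<Rightarrow> complex \<Rightarrow> complex \<Rightarrow> complex" where
  "diff_kernel f z w =
     (if w = z then Lim (at z) (\<lambda>u. (u + z) / (u - z) * (f u - f z))
      else (w + z) / (w - z) * (f w - f z))"

definition HP_remainder ::
  "nat \<Rightarrow> (nat \<Rightarrow> complex measure) \<Rightarrow> (nat \<Rightarrow> complex \<Rightarrow> complex) \<Rightarrow> (complex \<Rightarrow> complex) \<Rightarrow> complex \<Rightarrow> complex"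
  where "HP_remainder r \<mu> \<xi> \<upsilon> z = (\<Sum>j=1..r. \<xi> j z * caratheodory (\<mu> j) z) + \<upsilon> z"

end

theory Submission
  imports Defs
begin

text \<open>Let \<open>V\<close> be the right-hand side of (5) and \<open>s k\<close> the left-hand side of (4). Since
  \<open>(w + z) (w\<^sup>k - z\<^sup>k) / (w - z)\<close> is a Laurent polynomial in \<open>z\<close> and \<open>w\<close>, \<open>V\<close> lies in the required span,
  and off the unit circle \<open>\<Sum> \<xi>\<^sub>j F\<^sub>j + V = \<Sum> \<integral> (w + z) / (w - z) \<xi>\<^sub>j(w) d\<mu>\<^sub>j(w)\<close>. Expanding the kernel in
  powers of \<open>z / w\<close> or \<open>w / z\<close>, this is \<open>s 0 + 2 s 1 z + 2 s 2 z\<^sup>2 + \<dots>\<close> near \<open>0\<close> and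
  \<open>- s 0 - 2 s (-1) z\<^sup>-\<^sup>1 - 2 s (-2) z\<^sup>-\<^sup>2 - \<dots>\<close> near infinity, so (4) gives (2) and (3). Conversely, under
  (2) and (3) the Laurent polynomial \<open>\<upsilon> - V\<close> is bounded near \<open>0\<close> and near infinity, hence constant; the
  opposite signs of \<open>s 0\<close> in the two expansions make both this constant and \<open>s 0\<close> vanish, and the remaining
  coefficients give (4).\<close>

section \<open>Integration over the unit circle\<close>

lemma space_prob_measure_on_circle:
  assumes "prob_measure_on_circle M"
  shows "space M = sphere 0 1"
  using assms sets_eq_imp_space_eq[of M "restrict_space borel (sphere 0 1)"]
  by (simp add: prob_measure_on_circle_def space_restrict_space)

text \<open>Compactness of the circle bounds \<open>g\<close>, and a bounded measurable function is
  integrable for a probability measure. This supplies the integrability conditions below.\<close>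

lemma integrable_circle_continuous:
  fixes g :: "complex \<Rightarrow> 'b :: {banach, second_countable_topology}"
  assumes M: "prob_measure_on_circle M" and g: "continuous_on (sphere 0 1) g"
  shows "integrable M g"
proof -
  have sets: "sets M = sets (restrict_space borel (sphere 0 1))" and "prob_space M"
    using M by (auto simp: prob_measure_on_circle_def)
  interpret prob_space M by fact
  have space: "space M = sphere 0 1"
    using M by (rule space_prob_measure_on_circle)
  have "bounded (g ` sphere 0 1)"
    using g by (intro compact_imp_bounded compact_continuous_image) auto
  then obtain B where "\<And>w. w \<in> sphere 0 1 \<Longrightarrow> norm (g w) \<le> B"
    unfolding bounded_iff by blast
  moreover have "g \<in> borel_measurable M"
    using borel_measurable_continuous_on_restrict[OF g] measurable_cong_sets[OF sets refl] by blast
  ultimately show ?thesis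
    by (intro integrable_const_bound[of _ B] AE_I2) (auto simp: space)
qed

section \<open>Truncated expansion of the Herglotz kernel\<close>

text \<open>Taylor coefficients of \<open>(1 + q) / (1 - q)\<close>; both \<open>k\<close> and \<open>- k\<close> are used as indices, for the
  expansions at \<open>0\<close> and at infinity.\<close>

definition herglotz_coeff :: "int \<Rightarrow> complex" where
  "herglotz_coeff k = (if k = 0 then 1 else 2)"

text \<open>One more term is split off by \<open>(1 + q) / (1 - q) = 1 + q * (2 / (1 - q))\<close>
  for the first and \<open>2 / (1 - q) = 2 + q * (2 / (1 - q))\<close> for every later one, hence
  the case \<open>N = 0\<close> in the tail. The closed tail avoids exchanging an infinite series
  with an integral.\<close>

lemma herglotz_truncation:
  fixes q :: complex
  assumes "q \<noteq> 1"
  shows "(1 + q) / (1 - q) = (\<Sum>m<N. herglotz_coeff (int m) * q ^ m)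
           + q ^ N * ((if N = 0 then 1 + q else 2) / (1 - q))"
proof (induction N)
  case (Suc N)
  have "(if N = 0 then 1 + q else 2) / (1 - q) = herglotz_coeff (int N) + q * (2 / (1 - q))"
    using assms by (auto simp: herglotz_coeff_def field_simps)
  then show ?case
    using Suc by (simp add: algebra_simps)
qed simp

lemma herglotz_truncation_bound:
  fixes q :: complex
  assumes "norm q \<le> 1 / 2"
  shows "norm ((if N = (0::nat) then 1 + q else 2) / (1 - q)) \<le> 4"
proof -
  have "norm (1 + q) \<le> 2" 
    using norm_triangle_ineq[of 1 q] assms by simp
  moreover have "1 / 2 \<le> norm (1 - q)"
    using norm_triangle_ineq2[of 1 q] assms by simp
  ultimately have "norm (if N = 0 then 1 + q else 2) / norm (1 - q) \<le> 2 / (1 / 2)"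
    by (intro frac_le) auto
  then show ?thesis
    by (simp add: norm_divide)
qed

text \<open>Common source of both expansions: \<open>b\<close> will be \<open>inverse\<close> with
  \<open>u = z\<close> near 0, and the identity with \<open>u = 1 / z\<close> near infinity. The
  truncation is applied under the integral, where the tail is bounded uniformly in
  \<open>u\<close>.\<close>

lemma herglotz_integral_expansion:
  fixes f b :: "complex \<Rightarrow> complex"
  assumes M: "prob_measure_on_circle M"
    and f: "continuous_on (sphere 0 1) f" and b: "continuous_on (sphere 0 1) b"
    and norm_b: "\<And>w. norm w = 1 \<Longrightarrow> norm (b w) = 1"
  shows "(\<lambda>u. (LINT w|M. (1 + u * b w) / (1 - u * b w) * f w)
            - (\<Sum>m<N. herglotz_coeff (int m) * (LINT w|M. f w * b w ^ m) * u ^ m)) \<in> O[at 0](\<lambda>u. u ^ N)"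
proof (rule bigoI)
  let ?E = "\<lambda>q::complex. (if N = 0 then 1 + q else 2) / (1 - q)"
  \<comment> \<open>The factor 4 is the bound on the tail for arguments of norm at most 1/2; the
    powers of \<open>b w\<close> have norm 1.\<close>
  have "norm ((LINT w|M. (1 + u * b w) / (1 - u * b w) * f w)
            - (\<Sum>m<N. herglotz_coeff (int m) * (LINT w|M. f w * b w ^ m) * u ^ m))
          \<le> (LINT w|M. 4 * norm (f w)) * norm (u ^ N)"
    if u: "norm u \<le> 1 / 2" for u
  proof -
    have small: "norm (u * b w) \<le> 1 / 2" if "norm w = 1" for w
      using u norm_b[OF that] by (simp add: norm_mult)
    have ne: "u * b w \<noteq> 1" if "norm w = 1" for w
      using small[OF that] by auto
    have contE: "continuous_on (sphere 0 1) (\<lambda>w. b w ^ N * ?E (u * b w) * f w)"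
      using ne by (cases "N = 0") (auto intro!: continuous_intros f b)
    have "(LINT w|M. (1 + u * b w) / (1 - u * b w) * f w)
        = (LINT w|M. (\<Sum>m<N. herglotz_coeff (int m) * u ^ m * (f w * b w ^ m)) + u ^ N * (b w ^ N * ?E (u * b w) * f w))"
    proof (rule Bochner_Integration.integral_cong[OF refl])
      fix w assume "w \<in> space M"
      then have "norm w = 1" using space_prob_measure_on_circle[OF M] by simp
      then show "(1 + u * b w) / (1 - u * b w) * f w
          = (\<Sum>m<N. herglotz_coeff (int m) * u ^ m * (f w * b w ^ m)) + u ^ N * (b w ^ N * ?E (u * b w) * f w)"
        by (subst herglotz_truncation[OF ne, of w N])
           (simp_all add: distrib_right distrib_left sum_distrib_left power_mult_distrib mult_ac)
    qed
    also have "\<dots> = (\<Sum>m<N. herglotz_coeff (int m) * u ^ m * (LINT w|M. f w * b w ^ m))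
        + u ^ N * (LINT w|M. b w ^ N * ?E (u * b w) * f w)"
    proof -
      have 1: "integrable M (\<lambda>w. herglotz_coeff (int m) * u ^ m * (f w * b w ^ m))" for m
        by (intro integrable_circle_continuous[OF M] continuous_intros f b)
      have "(LINT w|M. (\<Sum>m<N. herglotz_coeff (int m) * u ^ m * (f w * b w ^ m)) + u ^ N * H w)
          = (\<Sum>m<N. herglotz_coeff (int m) * u ^ m * (LINT w|M. f w * b w ^ m)) + u ^ N * (LINT w|M. H w)"
        if "integrable M H" for H
        by (subst Bochner_Integration.integral_add)
           (use 1 that in \<open>auto simp: Bochner_Integration.integral_sum\<close>)
      from this[OF integrable_circle_continuous[OF M contE]] show ?thesis .
    qed
    finally have "(LINT w|M. (1 + u * b w) / (1 - u * b w) * f w)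
          - (\<Sum>m<N. herglotz_coeff (int m) * (LINT w|M. f w * b w ^ m) * u ^ m)
        = u ^ N * (LINT w|M. b w ^ N * ?E (u * b w) * f w)"
      by (simp add: mult_ac)
    moreover have "norm (LINT w|M. b w ^ N * ?E (u * b w) * f w) \<le> (LINT w|M. 4 * norm (f w))"
    proof (rule Bochner_Integration.integral_norm_bound_integral)
      show "integrable M (\<lambda>w. b w ^ N * ?E (u * b w) * f w)"
        by (rule integrable_circle_continuous[OF M contE])
      show "integrable M (\<lambda>w. 4 * norm (f w))"
        by (intro integrable_circle_continuous[OF M] continuous_intros f)
      fix w assume "w \<in> space M"
      then have "norm w = 1" using space_prob_measure_on_circle[OF M] by simp
      from herglotz_truncation_bound[OF small[OF this], of N] \<open>norm w = 1\<close>
      show "norm (b w ^ N * ?E (u * b w) * f w) \<le> 4 * norm (f w)"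
        by (simp only: norm_mult norm_power norm_b power_one mult_1_left mult_right_mono norm_ge_zero)
    qed
    ultimately show ?thesis
      by (simp add: norm_mult mult.commute mult_left_mono)
  qed
  moreover have "eventually (\<lambda>u::complex. norm u \<le> 1 / 2) (at 0)"
    unfolding eventually_at by (rule exI[of _ "1/2"]) auto
  ultimately show "eventually (\<lambda>u. norm ((LINT w|M. (1 + u * b w) / (1 - u * b w) * f w)
            - (\<Sum>m<N. herglotz_coeff (int m) * (LINT w|M. f w * b w ^ m) * u ^ m))
          \<le> (LINT w|M. 4 * norm (f w)) * norm (u ^ N)) (at 0)"
    by (auto elim!: eventually_mono)
qed

section \<open>Coefficients of Laurent polynomials under growth bounds\<close>

text \<open>If a coefficient below \<open>N\<close> survived, the lowest surviving exponent
  \<open>p\<close> would satisfy \<open>p < N\<close>. Division by \<open>z powi p\<close> leaves a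
  polynomial with constant term \<open>c p\<close> that tends to 0, so \<open>c p = 0\<close>, a
  contradiction.\<close>

lemma laurent_coeff_eq_0_at_0:
  fixes c :: "int \<Rightarrow> complex"
  assumes fin: "finite A"
    and O: "(\<lambda>z. \<Sum>k\<in>A. c k * z powi k) \<in> O[at 0](\<lambda>z. z powi N)"
    and k: "k \<in> A" "k < N"
  shows "c k = 0"
proof (rule ccontr)
  assume "c k \<noteq> 0"
  \<comment> \<open>Discarding zero coefficients first makes the coefficient at the minimum nonzero,
    and all exponents \<open>i - p\<close> natural numbers.\<close>
  define B where "B = {i \<in> A. c i \<noteq> 0}"
  define p where "p = Min B"
  have B: "finite B" "k \<in> B" using fin k \<open>c k \<noteq> 0\<close> by (auto simp: B_def)
  then have p: "p \<in> B" "p \<le> k" "\<And>i. i \<in> B \<Longrightarrow> p \<le> i"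
    unfolding p_def using Min_in[of B] by (blast intro: Min_le)+
  have ev: "eventually (\<lambda>z::complex. z \<noteq> 0) (at 0)"
    by (simp add: eventually_at_filter)
  have "(\<lambda>z. z powi (- p) * (\<Sum>k\<in>A. c k * z powi k)) \<in> O[at 0](\<lambda>z. z powi (- p) * z powi N)"
    by (intro landau_o.big.mult O landau_o.big_refl)
  moreover have eq1: "eventually (\<lambda>z. z powi (- p) * (\<Sum>k\<in>A. c k * z powi k)
      = (\<Sum>i\<in>B. c i * z ^ nat (i - p))) (at 0)"
    using ev
  proof eventually_elim
    case (elim z)
    have "z powi (- p) * (\<Sum>k\<in>A. c k * z powi k) = (\<Sum>k\<in>A. c k * z powi (k - p))"
      using elim by (simp add: sum_distrib_left power_int_diff power_int_minus field_simps)
    also have "\<dots> = (\<Sum>k\<in>B. c k * z powi (k - p))"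
      unfolding B_def using fin by (intro sum.mono_neutral_right) auto
    also have "\<dots> = (\<Sum>i\<in>B. c i * z ^ nat (i - p))"
      using p by (intro sum.cong) (auto simp: power_int_def)
    finally show ?case .
  qed
  moreover have eq2: "eventually (\<lambda>z::complex. z powi (- p) * z powi N = z ^ nat (N - p)) (at 0)"
    using ev
  proof eventually_elim
    case (elim z)
    then have "z powi (- p) * z powi N = z powi (N - p)"
      by (simp add: power_int_diff power_int_minus field_simps)
    then show ?case using p k by (simp add: power_int_def)
  qed
  ultimately have O': "(\<lambda>z. \<Sum>i\<in>B. c i * z ^ nat (i - p)) \<in> O[at 0](\<lambda>z. z ^ nat (N - p))"
    by (simp only: landau_o.big.cong_ex[OF eq1 eq2])
  have "((\<lambda>z::complex. z ^ nat (N - p)) \<longlongrightarrow> 0 ^ nat (N - p)) (at 0)"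
    by (intro tendsto_intros)
  then have lim_pow: "((\<lambda>z::complex. z ^ nat (N - p)) \<longlongrightarrow> 0) (at 0)"
    using p k by (simp add: power_0_left)
  obtain C where "eventually (\<lambda>z. norm (\<Sum>i\<in>B. c i * z ^ nat (i - p)) \<le> C * norm (z ^ nat (N - p))) (at 0)"
    using O' by (elim landau_o.bigE)
  then have lim0: "((\<lambda>z. \<Sum>i\<in>B. c i * z ^ nat (i - p)) \<longlongrightarrow> 0) (at 0)"
    by (intro tendsto_0_le[OF lim_pow, of _ C]) (simp add: mult.commute)
  have "((\<lambda>z. \<Sum>i\<in>B. c i * z ^ nat (i - p)) \<longlongrightarrow> (\<Sum>i\<in>B. c i * 0 ^ nat (i - p))) (at 0)"
    by (intro tendsto_intros)
  from tendsto_unique[OF _ this lim0] have "(\<Sum>i\<in>B. c i * 0 ^ nat (i - p)) = 0"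
    by simp
  \<comment> \<open>Since \<open>0 ^ 0 = 1\<close>, exactly the term \<open>i = p\<close>
    survives.\<close>
  moreover have "(\<Sum>i\<in>B. c i * 0 ^ nat (i - p)) = (\<Sum>i\<in>B. if i = p then c i else 0)"
    using p by (intro sum.cong) (force simp: power_0_left)+
  moreover have "\<dots> = c p" using p B by simp
  ultimately have "c p = 0"
    by simp
  then show False using p by (simp add: B_def)
qed

text \<open>The substitution of \<open>1 / z\<close> for \<open>z\<close> negates all exponents and
  moves infinity to 0.\<close>

lemma laurent_coeff_eq_0_at_infinity:
  fixes c :: "int \<Rightarrow> complex"
  assumes fin: "finite A"
    and O: "(\<lambda>z. \<Sum>k\<in>A. c k * z powi k) \<in> O[at_infinity](\<lambda>z. z powi N)"
    and k: "k \<in> A" "N < k"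
  shows "c k = 0"
proof -
  have "((\<lambda>z. \<Sum>k\<in>A. c k * z powi k) \<circ> inverse) \<in> O[at 0]((\<lambda>z. z powi N) \<circ> inverse)"
    unfolding comp_def using O filterlim_inverse_at_infinity by (rule landau_o.big.compose)
  \<comment> \<open>This is an equality of total functions: it also holds at 0, because
    \<open>inverse 0 = 0\<close>.\<close>
  also have "(\<lambda>z. \<Sum>k\<in>A. c k * z powi k) \<circ> inverse
      = (\<lambda>z. \<Sum>k\<in>uminus ` A. c (- k) * z powi k)"
    by (subst sum.reindex) (auto simp: fun_eq_iff power_int_inverse power_int_minus inj_on_def)
  also have "(\<lambda>z::complex. z powi N) \<circ> inverse = (\<lambda>z. z powi (- N))"
    by (auto simp: fun_eq_iff power_int_inverse power_int_minus)
  finally have "c (- (- k)) = 0"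
    by (rule laurent_coeff_eq_0_at_0[rotated]) (use fin k in auto)
  then show ?thesis by simp
qed

section \<open>Laurent spans and the difference kernel\<close>

lemma laurent_span_mono:
  assumes f: "f \<in> laurent_span a b" and "a' \<le> a" "b \<le> b'"
  shows "f \<in> laurent_span a' b'"
proof -
  obtain c where "f = (\<lambda>z. \<Sum>k=a..b. c k * z powi k)"
    using f by (auto simp: laurent_span_def)
  also have "\<dots> = (\<lambda>z. \<Sum>k=a'..b'. (if k \<in> {a..b} then c k else 0) * z powi k)"
    using assms by (intro ext sum.mono_neutral_cong_left) auto
  finally show ?thesis
    unfolding laurent_span_def by (intro CollectI exI[of _ "\<lambda>k. if k \<in> {a..b} then c k else 0"])
qed

lemma continuous_on_laurent_span:
  assumes "f \<in> laurent_span a b"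
  shows "continuous_on (- {0}) f"
proof -
  obtain c where c: "f = (\<lambda>z. \<Sum>k=a..b. c k * z powi k)"
    using assms by (auto simp: laurent_span_def)
  show ?thesis
    unfolding c by (intro continuous_intros) auto
qed

text \<open>With \<open>K\<^sub>k = (w + z) (w\<^sup>k - z\<^sup>k) / (w - z)\<close> one has
  \<open>K\<^sub>k\<^sub>+\<^sub>1 = w K\<^sub>k + (w + z) z\<^sup>k\<close>, which is iterated from \<open>K\<^sub>0 = 0\<close> in both directions.\<close>

lemma kernel_monomial_nonneg:
  assumes "int m \<le> int l - 1"
  shows "\<exists>g. (\<forall>i. continuous_on (- {0}) (g i)) \<and>
           (\<forall>z w :: complex. z \<noteq> 0 \<longrightarrow> w \<noteq> 0 \<longrightarrow> (w + z) * (w powi int m - z powi int m)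
              = (w - z) * (\<Sum>i=- int l..int l - 1. g i w * z powi i))"
  using assms
proof (induction m)
  case 0
  then show ?case by (intro exI[of _ "\<lambda>_ _. 0"]) simp
next
  case (Suc m)
  then obtain g where cont: "\<And>i. continuous_on (- {0}) (g i)"
    and g: "\<And>z w :: complex. z \<noteq> 0 \<Longrightarrow> w \<noteq> 0 \<Longrightarrow> (w + z) * (w powi int m - z powi int m)
              = (w - z) * (\<Sum>i=- int l..int l - 1. g i w * z powi i)"
    by auto
  \<comment> \<open>The added term \<open>(w + z) * z powi int m\<close> contributes
    \<open>w\<close> to the coefficient of \<open>z powi int m\<close> and 1 to the next
    one.\<close>
  define h where "h = (\<lambda>i w. w * g i w + (if i = int m then w else 0) + (if i = int m + 1 then 1 else 0))"
  have "continuous_on (- {0}) (h i)" for i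
    unfolding h_def by (cases "i = int m"; cases "i = int m + 1") (auto intro!: continuous_intros cont)
  moreover have "(w + z) * (w powi int (Suc m) - z powi int (Suc m))
      = (w - z) * (\<Sum>i=- int l..int l - 1. h i w * z powi i)" if "z \<noteq> 0" "w \<noteq> 0" for z w
  proof -
    have "(\<Sum>i=- int l..int l - 1. h i w * z powi i) = w * (\<Sum>i=- int l..int l - 1. g i w * z powi i)
        + (\<Sum>i=- int l..int l - 1. if i = int m then w * z powi i else 0)
        + (\<Sum>i=- int l..int l - 1. if i = int m + 1 then z powi i else 0)"
      unfolding h_def sum_distrib_left sum.distrib[symmetric]
      by (intro sum.cong refl) (auto simp: algebra_simps)
    \<comment> \<open>Both exponents \<open>m\<close> and \<open>m + 1\<close> lie in the summation
      range because \<open>m + 1 \<le> l - 1\<close>.\<close>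
    also have "\<dots> = w * (\<Sum>i=- int l..int l - 1. g i w * z powi i) + (w + z) * z powi int m"
      using Suc.prems that by (simp add: power_int_add algebra_simps)
    finally have "(w - z) * (\<Sum>i=- int l..int l - 1. h i w * z powi i)
        = w * ((w + z) * (w powi int m - z powi int m)) + (w - z) * ((w + z) * z powi int m)"
      unfolding g[OF that] by (simp add: algebra_simps)
    then show ?thesis
      using that by (simp add: power_int_add algebra_simps)
  qed
  ultimately show ?case by blast
qed

lemma kernel_monomial_nonpos:
  assumes "m \<le> l"
  shows "\<exists>g. (\<forall>i. continuous_on (- {0}) (g i)) \<and>
           (\<forall>z w :: complex. z \<noteq> 0 \<longrightarrow> w \<noteq> 0 \<longrightarrow> (w + z) * (w powi (- int m) - z powi (- int m))
              = (w - z) * (\<Sum>i=- int l..int l - 1. g i w * z powi i))"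
  using assms
proof (induction m)
  case 0
  then show ?case by (intro exI[of _ "\<lambda>_ _. 0"]) simp
next
  case (Suc m)
  then obtain g where cont: "\<And>i. continuous_on (- {0}) (g i)"
    and g: "\<And>z w :: complex. z \<noteq> 0 \<Longrightarrow> w \<noteq> 0 \<Longrightarrow> (w + z) * (w powi (- int m) - z powi (- int m))
              = (w - z) * (\<Sum>i=- int l..int l - 1. g i w * z powi i)"
    by auto
  \<comment> \<open>The recursion is solved for the kernel of the lower exponent, which costs a
    division by \<open>w\<close>; hence continuity is claimed away from 0.\<close>
  define h where "h = (\<lambda>i w. (g i w - (if i = - int m - 1 then w else 0) - (if i = - int m then 1 else 0)) / w)"
  have "continuous_on (- {0}) (h i)" for i
    unfolding h_def by (cases "i = - int m"; cases "i = - int m - 1") (auto intro!: continuous_intros cont)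
  moreover have "(w + z) * (w powi (- int (Suc m)) - z powi (- int (Suc m)))
      = (w - z) * (\<Sum>i=- int l..int l - 1. h i w * z powi i)" if "z \<noteq> 0" "w \<noteq> 0" for z w
  proof -
    have zm: "z powi (- int m) = z * z powi (- int m - 1)"
      using that by (simp add: power_int_diff)
    have wm: "w powi (- int m) = w * w powi (- int m - 1)"
      using that by (simp add: power_int_diff)
    have "w * (\<Sum>i=- int l..int l - 1. h i w * z powi i) = (\<Sum>i=- int l..int l - 1. g i w * z powi i)
        - (\<Sum>i=- int l..int l - 1. if i = - int m - 1 then w * z powi i else 0)
        - (\<Sum>i=- int l..int l - 1. if i = - int m then z powi i else 0)"
      unfolding h_def sum_distrib_left sum_subtractf[symmetric]
      using that by (intro sum.cong refl) (auto simp: field_simps)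
    \<comment> \<open>From \<open>m + 1 \<le> l\<close> both \<open>- m - 1\<close> and
      \<open>- m\<close> lie in the range; in particular \<open>l > 0\<close>, so exponent 0 is
      allowed.\<close>
    also have "\<dots> = (\<Sum>i=- int l..int l - 1. g i w * z powi i) - (w + z) * z powi (- int m - 1)"
      using Suc.prems by (simp add: zm distrib_right sum.delta)
    finally have wS: "w * (\<Sum>i=- int l..int l - 1. h i w * z powi i)
        = (\<Sum>i=- int l..int l - 1. g i w * z powi i) - (w + z) * z powi (- int m - 1)" .
    have "w * ((w - z) * (\<Sum>i=- int l..int l - 1. h i w * z powi i))
        = (w - z) * (w * (\<Sum>i=- int l..int l - 1. h i w * z powi i))"
      by (rule mult.left_commute)
    also have "\<dots> = (w + z) * (w powi (- int m) - z powi (- int m))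
        - (w - z) * ((w + z) * z powi (- int m - 1))"
      unfolding g[OF that] wS by (rule right_diff_distrib)
    also have "\<dots> = w * ((w + z) * (w powi (- int m - 1) - z powi (- int m - 1)))"
      unfolding zm wm by (simp add: algebra_simps)
    finally have "(w - z) * (\<Sum>i=- int l..int l - 1. h i w * z powi i)
        = (w + z) * (w powi (- int m - 1) - z powi (- int m - 1))"
      using that by simp
    moreover have "- int (Suc m) = - int m - 1" by simp
    ultimately show ?thesis by (simp only:)
  qed
  ultimately show ?case by blast
qed

lemma kernel_monomial:
  assumes "- int l \<le> k" "k \<le> int l - 1"
  shows "\<exists>g. (\<forall>i. continuous_on (- {0}) (g i)) \<and>
           (\<forall>z w :: complex. z \<noteq> 0 \<longrightarrow> w \<noteq> 0 \<longrightarrow> (w + z) * (w powi k - z powi k)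
              = (w - z) * (\<Sum>i=- int l..int l - 1. g i w * z powi i))"
proof (cases "k \<ge> 0")
  case True
  then show ?thesis using kernel_monomial_nonneg[of "nat k" l] assms by simp
next
  case False
  then show ?thesis using kernel_monomial_nonpos[of "nat (- k)" l] assms by simp
qed

text \<open>By linearity it suffices to treat monomials, and dividing their identities by
  \<open>w - z\<close> settles \<open>w \<noteq> z\<close>. On the diagonal the right-hand side is
  continuous in \<open>w\<close>, so it equals the limit in \<open>diff_kernel\<close>. Hence the
  formula also covers atoms at a point \<open>z\<close> of the circle.\<close>

lemma diff_kernel_laurent:
  assumes f: "f \<in> laurent_span (- int l) (int l - 1)"
  shows "\<exists>g. (\<forall>i. continuous_on (- {0}) (g i)) \<and>
           (\<forall>z w. z \<noteq> 0 \<longrightarrow> w \<noteq> 0 \<longrightarrow>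
              diff_kernel f z w = (\<Sum>i=- int l..int l - 1. g i w * z powi i))"
proof -
  let ?I = "{- int l..int l - 1}"
  obtain c where c: "f = (\<lambda>z. \<Sum>k\<in>?I. c k * z powi k)"
    using f by (auto simp: laurent_span_def)
  have "\<forall>k\<in>?I. \<exists>g. (\<forall>i. continuous_on (- {0}) (g i)) \<and>
           (\<forall>z w :: complex. z \<noteq> 0 \<longrightarrow> w \<noteq> 0 \<longrightarrow> (w + z) * (w powi k - z powi k)
              = (w - z) * (\<Sum>i\<in>?I. g i w * z powi i))"
    using kernel_monomial by auto
  then obtain G :: "int \<Rightarrow> int \<Rightarrow> complex \<Rightarrow> complex"
    where cont: "\<And>k i. k \<in> ?I \<Longrightarrow> continuous_on (- {0}) (G k i)"
    and G: "\<And>k z w. k \<in> ?I \<Longrightarrow> z \<noteq> 0 \<Longrightarrow> w \<noteq> 0 \<Longrightarrow> (w + z) * (w powi k - z powi k)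
              = (w - z) * (\<Sum>i\<in>?I. G k i w * z powi i)"
    by metis
  define g where "g = (\<lambda>i w. \<Sum>k\<in>?I. c k * G k i w)"
  have cont_g: "continuous_on (- {0}) (g i)" for i
    unfolding g_def by (intro continuous_intros cont)
  have off: "(w + z) / (w - z) * (f w - f z) = (\<Sum>i\<in>?I. g i w * z powi i)"
    if "z \<noteq> 0" "w \<noteq> 0" "w \<noteq> z" for z w
  proof -
    have "(w + z) * (f w - f z) = (\<Sum>k\<in>?I. c k * ((w + z) * (w powi k - z powi k)))"
      unfolding c sum_subtractf[symmetric] sum_distrib_left
      by (intro sum.cong refl) (simp add: algebra_simps)
    also have "\<dots> = (\<Sum>k\<in>?I. c k * ((w - z) * (\<Sum>i\<in>?I. G k i w * z powi i)))"
      using that by (intro sum.cong refl) (subst G, auto)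
    also have "\<dots> = (w - z) * (\<Sum>k\<in>?I. \<Sum>i\<in>?I. c k * G k i w * z powi i)"
      by (simp add: sum_distrib_left mult_ac)
    also have "(\<Sum>k\<in>?I. \<Sum>i\<in>?I. c k * G k i w * z powi i) = (\<Sum>i\<in>?I. g i w * z powi i)"
      unfolding g_def sum_distrib_right by (rule sum.swap)
    finally show ?thesis
      using that by (simp add: field_simps)
  qed
  have "diff_kernel f z w = (\<Sum>i\<in>?I. g i w * z powi i)" if "z \<noteq> 0" "w \<noteq> 0" for z w
  proof (cases "w = z")
    case True
    have "continuous_on (- {0}) (\<lambda>u. \<Sum>i\<in>?I. g i u * z powi i)"
      by (intro continuous_intros cont_g)
    then have "isCont (\<lambda>u. \<Sum>i\<in>?I. g i u * z powi i) z"
      using that by (subst (asm) continuous_on_eq_continuous_at) auto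
    then have "((\<lambda>u. \<Sum>i\<in>?I. g i u * z powi i) \<longlongrightarrow> (\<Sum>i\<in>?I. g i z * z powi i)) (at z)"
      by (simp add: isCont_def)
    \<comment> \<open>Near \<open>z\<close>, but not at it, the formula for
      \<open>w \<noteq> z\<close> is available.\<close>
    moreover have "eventually (\<lambda>u. u \<in> - {0} - {z}) (at z)"
      using that by (intro eventually_at_in_open) auto
    then have "eventually (\<lambda>u. (u + z) / (u - z) * (f u - f z) = (\<Sum>i\<in>?I. g i u * z powi i)) (at z)"
      by (rule eventually_mono) (use that off in auto)
    ultimately have "((\<lambda>u. (u + z) / (u - z) * (f u - f z)) \<longlongrightarrow> (\<Sum>i\<in>?I. g i z * z powi i)) (at z)"
      by (simp cong: tendsto_cong)
    then show ?thesis
      using True by (simp add: diff_kernel_def tendsto_Lim)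
  next
    case False
    then show ?thesis using off that by (simp add: diff_kernel_def)
  qed
  with cont_g show ?thesis by blast
qed

lemma continuous_on_circle:
  assumes "continuous_on (- {0}) (f :: complex \<Rightarrow> 'a :: topological_space)"
  shows "continuous_on (sphere 0 1) f"
  using assms by (rule continuous_on_subset) auto

text \<open>The powers of \<open>z\<close> do not depend on \<open>w\<close>, so integrating the
  finite expansion of the kernel term by term yields the Laurent coefficients.\<close>

lemma integral_diff_kernel_laurent_span:
  fixes \<mu> :: "'a \<Rightarrow> complex measure"
  assumes \<mu>: "\<And>j. j \<in> J \<Longrightarrow> prob_measure_on_circle (\<mu> j)"
    and \<xi>: "\<And>j. j \<in> J \<Longrightarrow> \<xi> j \<in> laurent_span (- int l) (int l - 1)"
  shows "\<exists>v\<in>laurent_span (- int l) (int l - 1).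
           \<forall>z. z \<noteq> 0 \<longrightarrow> v z = (\<Sum>j\<in>J. LINT w|\<mu> j. diff_kernel (\<xi> j) z w)"
proof -
  let ?I = "{- int l..int l - 1}"
  have "\<forall>j\<in>J. \<exists>g. (\<forall>i. continuous_on (- {0}) (g i)) \<and> (\<forall>z w. z \<noteq> 0 \<longrightarrow> w \<noteq> 0 \<longrightarrow>
              diff_kernel (\<xi> j) z w = (\<Sum>i\<in>?I. g i w * z powi i))"
    using diff_kernel_laurent \<xi> by blast
  then obtain G :: "'a \<Rightarrow> int \<Rightarrow> complex \<Rightarrow> complex"
    where cont: "\<And>j i. j \<in> J \<Longrightarrow> continuous_on (- {0}) (G j i)"
    and G: "\<And>j z w. j \<in> J \<Longrightarrow> z \<noteq> 0 \<Longrightarrow> w \<noteq> 0 \<Longrightarrow>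
              diff_kernel (\<xi> j) z w = (\<Sum>i\<in>?I. G j i w * z powi i)"
    by metis
  have int: "(LINT w|\<mu> j. diff_kernel (\<xi> j) z w) = (\<Sum>i\<in>?I. (LINT w|\<mu> j. G j i w) * z powi i)"
    if "j \<in> J" "z \<noteq> 0" for j z
  proof -
    have "(LINT w|\<mu> j. diff_kernel (\<xi> j) z w) = (LINT w|\<mu> j. (\<Sum>i\<in>?I. G j i w * z powi i))"
      using that space_prob_measure_on_circle[OF \<mu>[OF that(1)]]
      by (intro Bochner_Integration.integral_cong refl G) auto
    also have "\<dots> = (\<Sum>i\<in>?I. (LINT w|\<mu> j. G j i w * z powi i))"
      by (intro Bochner_Integration.integral_sum integrable_circle_continuous[OF \<mu>[OF that(1)]]
          continuous_intros continuous_on_circle cont that)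
    finally show ?thesis by simp
  qed
  let ?v = "\<lambda>z. \<Sum>i\<in>?I. (\<Sum>j\<in>J. LINT w|\<mu> j. G j i w) * z powi i"
  have "?v z = (\<Sum>j\<in>J. LINT w|\<mu> j. diff_kernel (\<xi> j) z w)" if "z \<noteq> 0" for z
  proof -
    have "?v z = (\<Sum>j\<in>J. \<Sum>i\<in>?I. (LINT w|\<mu> j. G j i w) * z powi i)"
      unfolding sum_distrib_right by (rule sum.swap)
    then show ?thesis using that by (simp add: int)
  qed
  moreover have "?v \<in> laurent_span (- int l) (int l - 1)"
    unfolding laurent_span_def by (intro CollectI exI[of _ "\<lambda>i. \<Sum>j\<in>J. LINT w|\<mu> j. G j i w"] refl)
  ultimately show ?thesis by (intro bexI[of _ ?v]) auto
qed

section \<open>Expansions of the remainder at 0 and at infinity\<close>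

text \<open>Off the circle the diagonal branch of \<open>diff_kernel\<close> is never met and the
  kernel is continuous in \<open>w\<close>, so the integral of the difference splits and the terms
  containing \<open>f z\<close> cancel.\<close>

lemma caratheodory_plus_diff_kernel:
  assumes M: "prob_measure_on_circle M" and f: "f \<in> laurent_span a b" and z: "norm z \<noteq> 1"
  shows "f z * caratheodory M z + (LINT w|M. diff_kernel f z w) = (LINT w|M. (w + z) / (w - z) * f w)"
proof -
  have ne: "w \<noteq> z" if "norm w = 1" for w using z that by auto
  have f': "continuous_on (sphere 0 1) f"
    using continuous_on_laurent_span[OF f] by (rule continuous_on_circle)
  have int: "integrable M (\<lambda>w. (w + z) / (w - z))" "integrable M (\<lambda>w. (w + z) / (w - z) * f w)"
    using ne by (intro integrable_circle_continuous[OF M] continuous_intros f'; auto)+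
  have "(LINT w|M. diff_kernel f z w) = (LINT w|M. (w + z) / (w - z) * f w - f z * ((w + z) / (w - z)))"
    using space_prob_measure_on_circle[OF M] ne
    by (intro Bochner_Integration.integral_cong refl)
       (auto simp: diff_kernel_def right_diff_distrib diff_divide_distrib)
  also have "\<dots> = (LINT w|M. (w + z) / (w - z) * f w) - f z * caratheodory M z"
    unfolding caratheodory_def
    by (subst Bochner_Integration.integral_diff)
       (use int in \<open>auto simp only: integral_mult_right_zero intro!: integrable_mult_right\<close>)
  finally show ?thesis by simp
qed

text \<open>The kernel equals \<open>(1 + q) / (1 - q)\<close> with
  \<open>q = z / w\<close>.\<close>

lemma circle_integral_expansion_at_0:
  assumes M: "prob_measure_on_circle M" and f: "f \<in> laurent_span a b"
  shows "(\<lambda>z. (LINT w|M. (w + z) / (w - z) * f w)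
           - (\<Sum>k\<in>{0..<int N}. herglotz_coeff k * (LINT w|M. f w * w powi (- k)) * z powi k))
         \<in> O[at 0](\<lambda>z. z powi int N)"
proof -
  have space: "norm w = 1" if "w \<in> space M" for w
    using that space_prob_measure_on_circle[OF M] by simp
  have "(\<lambda>z. (LINT w|M. (1 + z * inverse w) / (1 - z * inverse w) * f w)
      - (\<Sum>m<N. herglotz_coeff (int m) * (LINT w|M. f w * inverse w ^ m) * z ^ m)) \<in> O[at 0](\<lambda>z. z ^ N)"
    by (intro herglotz_integral_expansion[OF M] continuous_on_circle[OF continuous_on_laurent_span[OF f]]
        continuous_intros) (auto simp: norm_inverse)
  moreover have "(LINT w|M. (1 + z * inverse w) / (1 - z * inverse w) * f w)
      = (LINT w|M. (w + z) / (w - z) * f w)" for z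
  proof (intro Bochner_Integration.integral_cong refl)
    fix w assume "w \<in> space M"
    then have "w \<noteq> 0" using space by force
    then have "1 + z * inverse w = (w + z) / w" "1 - z * inverse w = (w - z) / w"
      by (simp_all add: field_simps)
    then show "(1 + z * inverse w) / (1 - z * inverse w) * f w = (w + z) / (w - z) * f w"
      using \<open>w \<noteq> 0\<close> by simp
  qed
  moreover have "(\<Sum>m<N. herglotz_coeff (int m) * (LINT w|M. f w * inverse w ^ m) * z ^ m)
      = (\<Sum>k\<in>{0..<int N}. herglotz_coeff k * (LINT w|M. f w * w powi (- k)) * z powi k)" for z
    by (rule sum.reindex_bij_witness[of _ nat int])
       (auto simp: power_int_minus power_inverse)
  ultimately show ?thesis by simp
qed

text \<open>With \<open>q = w / z\<close> the kernel equals \<open>- (1 + q) / (1 - q)\<close>; this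
  is where the opposite sign of the moment sum comes from.\<close>

lemma circle_integral_expansion_at_infinity:
  assumes M: "prob_measure_on_circle M" and f: "f \<in> laurent_span a b"
  shows "(\<lambda>z. (LINT w|M. (w + z) / (w - z) * f w)
           + (\<Sum>k\<in>{- int N<..0}. herglotz_coeff k * (LINT w|M. f w * w powi (- k)) * z powi k))
         \<in> O[at_infinity](\<lambda>z. z powi (- int N))"
proof -
  have lim: "filterlim inverse (at (0::complex)) at_infinity"
    by (simp add: filterlim_inverse_at_iff filterlim_ident)
  have ev: "eventually (\<lambda>z::complex. z \<noteq> 0) at_infinity"
    unfolding eventually_at_infinity by (rule exI[of _ 1]) auto
  have "(\<lambda>u. (LINT w|M. (1 + u * w) / (1 - u * w) * f w)
      - (\<Sum>m<N. herglotz_coeff (int m) * (LINT w|M. f w * w ^ m) * u ^ m)) \<in> O[at 0](\<lambda>u. u ^ N)"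
    by (intro herglotz_integral_expansion[OF M] continuous_on_circle[OF continuous_on_laurent_span[OF f]]
        continuous_intros) auto
  from landau_o.big.compose[OF this lim]
  have "(\<lambda>z. - ((LINT w|M. (1 + inverse z * w) / (1 - inverse z * w) * f w)
      - (\<Sum>m<N. herglotz_coeff (int m) * (LINT w|M. f w * w ^ m) * inverse z ^ m)))
      \<in> O[at_infinity](\<lambda>z. inverse z ^ N)"
    by (simp only: landau_o.big.uminus_in_iff)
  moreover have "eventually (\<lambda>z. - ((LINT w|M. (1 + inverse z * w) / (1 - inverse z * w) * f w)
      - (\<Sum>m<N. herglotz_coeff (int m) * (LINT w|M. f w * w ^ m) * inverse z ^ m))
      = (LINT w|M. (w + z) / (w - z) * f w)
           + (\<Sum>k\<in>{- int N<..0}. herglotz_coeff k * (LINT w|M. f w * w powi (- k)) * z powi k))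
      at_infinity"
    using ev
  proof eventually_elim
    case (elim z)
    have "(1 + inverse z * w) / (1 - inverse z * w) * f w = - ((w + z) / (w - z) * f w)" for w
    proof -
      have "1 + inverse z * w = (w + z) / z" "1 - inverse z * w = - (w - z) / z"
        using elim by (simp_all add: field_simps)
      then show ?thesis
        using elim by (simp only: divide_divide_eq_left divide_divide_eq_right) (simp add: minus_divide_right)
    qed
    moreover have "(\<Sum>m<N. herglotz_coeff (int m) * (LINT w|M. f w * w ^ m) * inverse z ^ m)
      = (\<Sum>k\<in>{- int N<..0}. herglotz_coeff k * (LINT w|M. f w * w powi (- k)) * z powi k)"
      by (rule sum.reindex_bij_witness[of _ "\<lambda>k. nat (- k)" "\<lambda>m. - int m"])
         (auto simp: power_int_minus power_inverse herglotz_coeff_def)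
    ultimately show ?case by simp
  qed
  moreover have "(\<lambda>z::complex. inverse z ^ N) = (\<lambda>z. z powi (- int N))"
    by (simp add: power_int_minus power_inverse fun_eq_iff)
  ultimately show ?thesis
    by (simp only: landau_o.big.in_cong)
qed

lemma HP_remainder_eq:
  assumes \<mu>: "\<forall>j\<in>{1..r}. prob_measure_on_circle (\<mu> j)"
    and \<xi>: "\<forall>j\<in>{1..r}. \<xi> j \<in> laurent_span a b"
    and z: "norm z \<noteq> 1"
  shows "HP_remainder r \<mu> \<xi> \<upsilon> z = (\<Sum>j=1..r. LINT w|\<mu> j. (w + z) / (w - z) * \<xi> j w)
           + (\<upsilon> z - (\<Sum>j=1..r. LINT w|\<mu> j. diff_kernel (\<xi> j) z w))"
proof -
  have "(\<Sum>j=1..r. LINT w|\<mu> j. (w + z) / (w - z) * \<xi> j w)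
      = (\<Sum>j=1..r. \<xi> j z * caratheodory (\<mu> j) z + (LINT w|\<mu> j. diff_kernel (\<xi> j) z w))"
    using assms by (intro sum.cong refl caratheodory_plus_diff_kernel[symmetric]) auto
  then show ?thesis
    by (simp add: HP_remainder_def sum.distrib)
qed

text \<open>The expansions for the individual measures are added up. \<open>D\<close> is the
  deviation of \<open>\<upsilon>\<close> from the kernel integral: a Laurent polynomial when
  \<open>\<upsilon>\<close> is given, and 0 when \<open>\<upsilon>\<close> is chosen as that
  integral.\<close>

lemma HP_remainder_expansion_at_0:
  assumes \<mu>: "\<forall>j\<in>{1..r}. prob_measure_on_circle (\<mu> j)"
    and \<xi>: "\<forall>j\<in>{1..r}. \<xi> j \<in> laurent_span a b"
    and D: "\<And>z. z \<noteq> 0 \<Longrightarrow> D z = \<upsilon> z - (\<Sum>j=1..r. LINT w|\<mu> j. diff_kernel (\<xi> j) z w)"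
  shows "(\<lambda>z. HP_remainder r \<mu> \<xi> \<upsilon> z - ((\<Sum>k\<in>{0..<int N}. herglotz_coeff k
              * (\<Sum>j=1..r. LINT w|\<mu> j. \<xi> j w * w powi (- k)) * z powi k) + D z))
         \<in> O[at 0](\<lambda>z. z powi int N)"
proof -
  have "(\<lambda>z. \<Sum>j=1..r. (LINT w|\<mu> j. (w + z) / (w - z) * \<xi> j w)
           - (\<Sum>k\<in>{0..<int N}. herglotz_coeff k * (LINT w|\<mu> j. \<xi> j w * w powi (- k)) * z powi k))
         \<in> O[at 0](\<lambda>z. z powi int N)"
    using \<mu> \<xi> by (intro big_sum_in_bigo circle_integral_expansion_at_0) auto
  moreover have "eventually (\<lambda>z::complex. norm z \<noteq> 1 \<and> z \<noteq> 0) (at 0)"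
    unfolding eventually_at by (rule exI[of _ 1]) auto
  then have "eventually (\<lambda>z. (\<Sum>j=1..r. (LINT w|\<mu> j. (w + z) / (w - z) * \<xi> j w)
           - (\<Sum>k\<in>{0..<int N}. herglotz_coeff k * (LINT w|\<mu> j. \<xi> j w * w powi (- k)) * z powi k))
      = HP_remainder r \<mu> \<xi> \<upsilon> z - ((\<Sum>k\<in>{0..<int N}. herglotz_coeff k
              * (\<Sum>j=1..r. LINT w|\<mu> j. \<xi> j w * w powi (- k)) * z powi k) + D z)) (at 0)"
  proof eventually_elim
    case (elim z)
    have "(\<Sum>k\<in>{0..<int N}. herglotz_coeff k * (\<Sum>j=1..r. LINT w|\<mu> j. \<xi> j w * w powi (- k)) * z powi k)
      = (\<Sum>j=1..r. \<Sum>k\<in>{0..<int N}. herglotz_coeff k * (LINT w|\<mu> j. \<xi> j w * w powi (- k)) * z powi k)"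
      unfolding sum_distrib_left sum_distrib_right by (rule sum.swap)
    then show ?case
      using elim HP_remainder_eq[OF \<mu> \<xi>, of z \<upsilon>] D by (simp add: sum_subtractf)
  qed
  ultimately show ?thesis
    by (simp only: landau_o.big.in_cong)
qed

text \<open>Here the moments change sign relative to the expansion at 0 while \<open>D\<close> does
  not, which lets the two constant terms be separated.\<close>

lemma HP_remainder_expansion_at_infinity:
  assumes \<mu>: "\<forall>j\<in>{1..r}. prob_measure_on_circle (\<mu> j)"
    and \<xi>: "\<forall>j\<in>{1..r}. \<xi> j \<in> laurent_span a b"
    and D: "\<And>z. z \<noteq> 0 \<Longrightarrow> D z = \<upsilon> z - (\<Sum>j=1..r. LINT w|\<mu> j. diff_kernel (\<xi> j) z w)"
  shows "(\<lambda>z. HP_remainder r \<mu> \<xi> \<upsilon> z - (D z - (\<Sum>k\<in>{- int N<..0}. herglotz_coeff k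
              * (\<Sum>j=1..r. LINT w|\<mu> j. \<xi> j w * w powi (- k)) * z powi k)))
         \<in> O[at_infinity](\<lambda>z. z powi (- int N))"
proof -
  have "(\<lambda>z. \<Sum>j=1..r. (LINT w|\<mu> j. (w + z) / (w - z) * \<xi> j w)
           + (\<Sum>k\<in>{- int N<..0}. herglotz_coeff k * (LINT w|\<mu> j. \<xi> j w * w powi (- k)) * z powi k))
         \<in> O[at_infinity](\<lambda>z. z powi (- int N))"
    using \<mu> \<xi> by (intro big_sum_in_bigo circle_integral_expansion_at_infinity) auto
  moreover have "eventually (\<lambda>z::complex. norm z \<noteq> 1 \<and> z \<noteq> 0) at_infinity"
    unfolding eventually_at_infinity by (rule exI[of _ 2]) auto
  then have "eventually (\<lambda>z. (\<Sum>j=1..r. (LINT w|\<mu> j. (w + z) / (w - z) * \<xi> j w)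
           + (\<Sum>k\<in>{- int N<..0}. herglotz_coeff k * (LINT w|\<mu> j. \<xi> j w * w powi (- k)) * z powi k))
      = HP_remainder r \<mu> \<xi> \<upsilon> z - (D z - (\<Sum>k\<in>{- int N<..0}. herglotz_coeff k
              * (\<Sum>j=1..r. LINT w|\<mu> j. \<xi> j w * w powi (- k)) * z powi k))) at_infinity"
  proof eventually_elim
    case (elim z)
    have "(\<Sum>k\<in>{- int N<..0}. herglotz_coeff k * (\<Sum>j=1..r. LINT w|\<mu> j. \<xi> j w * w powi (- k)) * z powi k)
      = (\<Sum>j=1..r. \<Sum>k\<in>{- int N<..0}. herglotz_coeff k * (LINT w|\<mu> j. \<xi> j w * w powi (- k)) * z powi k)"
      unfolding sum_distrib_left sum_distrib_right by (rule sum.swap)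
    then show ?case
      using elim HP_remainder_eq[OF \<mu> \<xi>, of z \<upsilon>] D by (simp add: sum.distrib)
  qed
  ultimately show ?thesis
    by (simp only: landau_o.big.in_cong)
qed

section \<open>Comparison of coefficients and the equivalence\<close>

text \<open>The expansion at \<open>0\<close> kills \<open>d k\<close> for \<open>k < 0\<close>, the one at infinity kills \<open>d k\<close> for \<open>k > 0\<close>,
  and the constant terms give \<open>s 0 + d 0 = 0 = d 0 - s 0\<close>.\<close>

lemma laurent_expansions_vanish:
  fixes s d :: "int \<Rightarrow> complex"
  assumes NL: "L = 0 \<or> 0 < N"
    and at_0: "(\<lambda>z. (\<Sum>k\<in>{0..<int N}. herglotz_coeff k * s k * z powi k)
                 + (\<Sum>k=- int L..int L - 1. d k * z powi k)) \<in> O[at 0](\<lambda>z. z powi int N)"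
    and at_inf: "(\<lambda>z. (\<Sum>k=- int L..int L - 1. d k * z powi k)
                 - (\<Sum>k\<in>{- int N<..0}. herglotz_coeff k * s k * z powi k)) \<in> O[at_infinity](\<lambda>z. z powi (- int N))"
  shows "k \<in> {- int L..int L - 1} \<Longrightarrow> d k = 0"
    and "k \<in> {- int N<..<int N} \<Longrightarrow> s k = 0"
proof -
  \<comment> \<open>Padding by zero brings the three coefficient families to one index range
    \<open>A\<close>, so that they can be added and compared termwise.\<close>
  define d' where "d' = (\<lambda>k. if k \<in> {- int L..int L - 1} then d k else 0)"
  define p where "p = (\<lambda>k. if k \<in> {0..<int N} then herglotz_coeff k * s k else 0)"
  define q where "q = (\<lambda>k. if k \<in> {- int N<..0} then herglotz_coeff k * s k else 0)"
  define A where "A = {- int L - int N..int L + int N}"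
  have d': "(\<Sum>k=- int L..int L - 1. d k * z powi k) = (\<Sum>k\<in>A. d' k * z powi k)" for z
    unfolding d'_def A_def by (intro sum.mono_neutral_cong_left) auto
  have p: "(\<Sum>k\<in>{0..<int N}. herglotz_coeff k * s k * z powi k) = (\<Sum>k\<in>A. p k * z powi k)" for z
    unfolding p_def A_def by (intro sum.mono_neutral_cong_left) auto
  have q: "(\<Sum>k\<in>{- int N<..0}. herglotz_coeff k * s k * z powi k) = (\<Sum>k\<in>A. q k * z powi k)" for z
    unfolding q_def A_def by (intro sum.mono_neutral_cong_left) auto
  have pd: "p k + d' k = 0" if "k \<in> A" "k < int N" for k
  proof (rule laurent_coeff_eq_0_at_0[of A "\<lambda>k. p k + d' k"])
    show "(\<lambda>z. \<Sum>k\<in>A. (p k + d' k) * z powi k) \<in> O[at 0](\<lambda>z. z powi int N)"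
      using at_0 by (simp add: d' p sum.distrib distrib_right)
  qed (use that in \<open>auto simp: A_def\<close>)
  have qd: "d' k - q k = 0" if "k \<in> A" "- int N < k" for k
  proof (rule laurent_coeff_eq_0_at_infinity[of A "\<lambda>k. d' k - q k"])
    show "(\<lambda>z. \<Sum>k\<in>A. (d' k - q k) * z powi k) \<in> O[at_infinity](\<lambda>z. z powi (- int N))"
      using at_inf by (simp add: d' q sum_subtractf left_diff_distrib)
  qed (use that in \<open>auto simp: A_def\<close>)
  have d'_0: "d' k = 0" for k
  proof (cases "k \<in> {- int L..int L - 1}")
    case True
    \<comment> \<open>A nonempty range forces \<open>L > 0\<close>. With \<open>N > 0\<close> the
      constant term is controlled by both growth conditions.\<close>
    then have "N > 0" using NL by auto
    consider "k < 0" | "k > 0" | "k = 0" by linarith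
    then show ?thesis
    proof cases
      case 1
      then show ?thesis using pd[of k] True by (auto simp: p_def A_def)
    next
      case 2
      then show ?thesis using qd[of k] True by (auto simp: q_def A_def)
    next
      case 3
      then have "s 0 + d' 0 = 0" "d' 0 - s 0 = 0"
        using pd[of 0] qd[of 0] \<open>N > 0\<close> by (auto simp: p_def q_def A_def herglotz_coeff_def)
      then have "d' 0 = 0" by algebra
      then show ?thesis using 3 by simp
    qed
  qed (auto simp: d'_def)
  show "d k = 0" if "k \<in> {- int L..int L - 1}"
    using d'_0[of k] that by (simp add: d'_def)
  \<comment> \<open>Once \<open>d'\<close> vanishes, \<open>herglotz_coeff k * s k = 0\<close>
    remains, and the factor is 1 or 2.\<close>
  show "s k = 0" if "k \<in> {- int N<..<int N}"
  proof (cases "k \<ge> 0")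
    case True
    then show ?thesis
      using pd[of k] that d'_0[of k] by (auto simp: p_def A_def herglotz_coeff_def split: if_splits)
  next
    case False
    then show ?thesis
      using qd[of k] that d'_0[of k] by (auto simp: q_def A_def herglotz_coeff_def split: if_splits)
  qed
qed

theorem theorem7p1:
  fixes r :: nat and \<mu> :: "nat \<Rightarrow> complex measure" and n :: "nat \<Rightarrow> nat"
    and l :: "nat \<Rightarrow> nat" and absl L :: nat
  assumes "r \<ge> 1"
    and "\<forall>j\<in>{1..r}. prob_measure_on_circle (\<mu> j)"
    and "\<forall>j\<in>{1..r}. even (n j)"
  defines "l \<equiv> \<lambda>j. n j div 2"
    and "absl \<equiv> (\<Sum>j=1..r. n j) div 2"
    and "L \<equiv> Max (l ` {1..r})"
  shows
    "(\<forall>(\<xi> :: nat \<Rightarrow> complex \<Rightarrow> complex) (\<upsilon> :: complex \<Rightarrow> complex).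
        (\<forall>j\<in>{1..r}. \<xi> j \<in> laurent_span (- int (l j)) (int (l j) - 1)) \<and>
        \<upsilon> \<in> laurent_span (- int L) (int L - 1) \<and>
        HP_remainder r \<mu> \<xi> \<upsilon> \<in> O[at 0](\<lambda>z. z powi int absl) \<and>
        HP_remainder r \<mu> \<xi> \<upsilon> \<in> O[at_infinity](\<lambda>z. z powi (- int absl))
        \<longrightarrow>
        (\<forall>k\<in>{- int absl + 1..int absl - 1}.
           (\<Sum>j=1..r. LINT w|\<mu> j. \<xi> j w * w powi (- k)) = 0) \<and>
        (\<forall>z. z \<noteq> 0 \<longrightarrow> \<upsilon> z = (\<Sum>j=1..r. LINT w|\<mu> j. diff_kernel (\<xi> j) z w)))
     \<and>
     (\<forall>\<xi> :: nat \<Rightarrow> complex \<Rightarrow> complex.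
        (\<forall>j\<in>{1..r}. \<xi> j \<in> laurent_span (- int (l j)) (int (l j) - 1)) \<and>
        (\<forall>k\<in>{- int absl + 1..int absl - 1}.
           (\<Sum>j=1..r. LINT w|\<mu> j. \<xi> j w * w powi (- k)) = 0)
        \<longrightarrow>
        (\<exists>\<upsilon>\<in>laurent_span (- int L) (int L - 1).
           (\<forall>z. z \<noteq> 0 \<longrightarrow> \<upsilon> z = (\<Sum>j=1..r. LINT w|\<mu> j. diff_kernel (\<xi> j) z w)) \<and>
           HP_remainder r \<mu> \<xi> \<upsilon> \<in> O[at 0](\<lambda>z. z powi int absl) \<and>
           HP_remainder r \<mu> \<xi> \<upsilon> \<in> O[at_infinity](\<lambda>z. z powi (- int absl))))"
proof -
  have \<mu>: "\<forall>j\<in>{1..r}. prob_measure_on_circle (\<mu> j)" by fact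
  have l_le_L: "l j \<le> L" if "j \<in> {1..r}" for j
    unfolding L_def using that by (intro Max_ge) auto
  \<comment> \<open>The maximum \<open>L\<close> is attained at some \<open>j\<close>, and
    \<open>n j\<close> is at most the whole sum, so \<open>L \<le> absl\<close>.\<close>
  have NL: "L = 0 \<or> 0 < absl"
  proof -
    have "L \<in> l ` {1..r}"
      unfolding L_def using \<open>r \<ge> 1\<close> by (intro Max_in) auto
    then obtain j where j: "j \<in> {1..r}" "L = l j" by blast
    have "n j \<le> (\<Sum>j=1..r. n j)"
      using j by (intro member_le_sum) auto
    then have "L \<le> absl"
      unfolding j(2) l_def absl_def by (rule div_le_mono)
    then show ?thesis by linarith
  qed
  let ?V = "\<lambda>(\<xi> :: nat \<Rightarrow> complex \<Rightarrow> complex) z. \<Sum>j=1..r. LINT w|\<mu> j. diff_kernel (\<xi> j) z w"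
  let ?s = "\<lambda>(\<xi> :: nat \<Rightarrow> complex \<Rightarrow> complex) k. \<Sum>j=1..r. LINT w|\<mu> j. \<xi> j w * w powi (- k)"
  let ?I = "{- int L..int L - 1}"
  have span: "\<forall>j\<in>{1..r}. \<xi> j \<in> laurent_span (- int L) (int L - 1)"
    if "\<forall>j\<in>{1..r}. \<xi> j \<in> laurent_span (- int (l j)) (int (l j) - 1)" for \<xi>
  proof
    fix j assume "j \<in> {1..r}"
    then show "\<xi> j \<in> laurent_span (- int L) (int L - 1)"
      using l_le_L[of j] by (intro laurent_span_mono[OF bspec[OF that]]) simp_all
  qed
  have V: "\<exists>v\<in>laurent_span (- int L) (int L - 1). \<forall>z. z \<noteq> 0 \<longrightarrow> v z = ?V \<xi> z"
    if "\<forall>j\<in>{1..r}. \<xi> j \<in> laurent_span (- int L) (int L - 1)" for \<xi>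
    using \<mu> that by (intro integral_diff_kernel_laurent_span) auto
  show ?thesis
  proof (intro conjI allI impI; elim conjE)
    fix \<xi> :: "nat \<Rightarrow> complex \<Rightarrow> complex" and \<upsilon> :: "complex \<Rightarrow> complex"
    assume \<xi>: "\<forall>j\<in>{1..r}. \<xi> j \<in> laurent_span (- int (l j)) (int (l j) - 1)"
      and \<upsilon>: "\<upsilon> \<in> laurent_span (- int L) (int L - 1)"
      and O0: "HP_remainder r \<mu> \<xi> \<upsilon> \<in> O[at 0](\<lambda>z. z powi int absl)"
      and Oinf: "HP_remainder r \<mu> \<xi> \<upsilon> \<in> O[at_infinity](\<lambda>z. z powi (- int absl))"
    obtain v where v: "v \<in> laurent_span (- int L) (int L - 1)" "\<And>z. z \<noteq> 0 \<Longrightarrow> v z = ?V \<xi> z"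
      using V[OF span[OF \<xi>]] by blast
    from \<upsilon> v obtain c e where c: "\<upsilon> = (\<lambda>z. \<Sum>k\<in>?I. c k * z powi k)"
      and e: "v = (\<lambda>z. \<Sum>k\<in>?I. e k * z powi k)"
      by (auto simp: laurent_span_def)
    \<comment> \<open>Writing the deviation of \<open>\<upsilon>\<close> from the kernel integral as
      one Laurent sum makes its coefficients accessible to the comparison.\<close>
    define D where "D = (\<lambda>z. \<Sum>k\<in>?I. (c k - e k) * z powi k)"
    have D: "D z = \<upsilon> z - ?V \<xi> z" if "z \<noteq> 0" for z
      unfolding v(2)[OF that, symmetric] by (simp add: D_def c e sum_subtractf left_diff_distrib)
    \<comment> \<open>Subtracting the expansion error from the assumed bound leaves the moment sum
      together with \<open>D\<close>.\<close>
    have at_0: "(\<lambda>z. (\<Sum>k\<in>{0..<int absl}. herglotz_coeff k * ?s \<xi> k * z powi k) + D z)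
        \<in> O[at 0](\<lambda>z. z powi int absl)"
      using sum_in_bigo(2)[OF O0 HP_remainder_expansion_at_0[OF \<mu> span[OF \<xi>] D, of absl]] by simp
    have at_inf: "(\<lambda>z. D z - (\<Sum>k\<in>{- int absl<..0}. herglotz_coeff k * ?s \<xi> k * z powi k))
        \<in> O[at_infinity](\<lambda>z. z powi (- int absl))"
      using sum_in_bigo(2)[OF Oinf HP_remainder_expansion_at_infinity[OF \<mu> span[OF \<xi>] D, of absl]] by simp
    note vanish = laurent_expansions_vanish[OF NL at_0[unfolded D_def] at_inf[unfolded D_def]]
    show "\<forall>k\<in>{- int absl + 1..int absl - 1}. ?s \<xi> k = 0"
      using vanish(2) by force
    have "D z = 0" for z
      unfolding D_def using vanish(1) by (intro sum.neutral) auto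
    then show "\<upsilon> z = ?V \<xi> z" if "z \<noteq> 0" for z
      using D[OF that] by simp
  next
    fix \<xi> :: "nat \<Rightarrow> complex \<Rightarrow> complex"
    assume \<xi>: "\<forall>j\<in>{1..r}. \<xi> j \<in> laurent_span (- int (l j)) (int (l j) - 1)"
      and s: "\<forall>k\<in>{- int absl + 1..int absl - 1}. ?s \<xi> k = 0"
    obtain v where v: "v \<in> laurent_span (- int L) (int L - 1)" "\<And>z. z \<noteq> 0 \<Longrightarrow> v z = ?V \<xi> z"
      using V[OF span[OF \<xi>]] by blast
    \<comment> \<open>For this choice of \<open>\<upsilon>\<close> the deviation is zero, and the
      orthogonality relations remove every moment in both expansions; the remainder is then itself
      the error term.\<close>
    have D: "0 = v z - ?V \<xi> z" if "z \<noteq> 0" for z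
      using v(2)[OF that] by simp
    have "(\<Sum>k\<in>{0..<int absl}. herglotz_coeff k * ?s \<xi> k * z powi k) = 0" for z
      using s by (intro sum.neutral) auto
    moreover have "(\<Sum>k\<in>{- int absl<..0}. herglotz_coeff k * ?s \<xi> k * z powi k) = 0" for z
      using s by (intro sum.neutral) auto
    ultimately have "HP_remainder r \<mu> \<xi> v \<in> O[at 0](\<lambda>z. z powi int absl)"
      "HP_remainder r \<mu> \<xi> v \<in> O[at_infinity](\<lambda>z. z powi (- int absl))"
      using HP_remainder_expansion_at_0[OF \<mu> span[OF \<xi>] D, of absl]
        HP_remainder_expansion_at_infinity[OF \<mu> span[OF \<xi>] D, of absl]
      by simp_all
    with v show "\<exists>\<upsilon>\<in>laurent_span (- int L) (int L - 1).
           (\<forall>z. z \<noteq> 0 \<longrightarrow> \<upsilon> z = ?V \<xi> z) \<and>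
           HP_remainder r \<mu> \<xi> \<upsilon> \<in> O[at 0](\<lambda>z. z powi int absl) \<and>
           HP_remainder r \<mu> \<xi> \<upsilon> \<in> O[at_infinity](\<lambda>z. z powi (- int absl))"
      by blast
  qed
qed

end
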